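(* Let $\phi:\mathbb{R}^{n-1}\to[0,+\infty)$ be a convex function of class $\mathscr{C}^1$ such that $$\lim_{|x|\to+\infty}\frac{x\cdot\nabla\phi(x)}{|x|}=+\infty.$$ Then the epigraph $E=\{(x,y)\in\mathbb{R}^{n-1}\times\mathbb{R}: y\ge\phi(x)\}$ has bounded convex exhaustion hulls (BCEH).
   Context: A closed convex set $E\subset\mathbb{R}^n$ has bounded convex exhaustion hulls (BCEH) if for every compact convex set $K\subset\mathbb{R}^n$ the set $h(E,K)=\mathrm{Conv}(E\cup K)\setminus E$ is bounded, where $\mathrm{Conv}$ denotes the convex hull. The dot denotes the Euclidean inner product. *)

theory Defs
  imports "HOL-Analysis.Analysis"
begin

text \<open>
  Bounded convex exhaustion hulls. The notion is only defined for closed convex sets,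
  so closedness and convexity of \<open>E\<close> are part of the predicate.
\<close>

definition BCEH :: "'a::euclidean_space set \<Rightarrow> bool" where
  "BCEH E \<longleftrightarrow> closed E \<and> convex E \<and>
     (\<forall>K. compact K \<and> convex K \<longrightarrow> bounded ((convex hull (E \<union> K)) - E))"

end

theory Submission
  imports Defs
begin

text \<open>
  Let \<open>E\<close> be the epigraph of \<open>\<phi>\<close> and \<open>K\<close> a compact convex set. A point \<open>(x, y)\<close> of
  \<open>Conv(E \<union> K) \<setminus> E\<close> lies on a segment from a point of \<open>E\<close> to a point \<open>(b, c)\<close> of \<open>K\<close>. The
  tangent hyperplane of \<open>\<phi>\<close> at \<open>x\<close> passes strictly above \<open>(x, y)\<close>, but nowhere strictly above
  \<open>E\<close>; so it passes strictly above the other end \<open>(b, c)\<close> of the segment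
  (\<open>hull_point_tangent_above\<close>).

  Such an \<open>x\<close> cannot be far away. Moving from \<open>b\<close> by a unit step in the direction of the
  gradient \<open>g\<close> at \<open>x\<close> raises the tangent hyperplane by \<open>norm g\<close>, and it still stays below
  \<open>\<phi>\<close>; hence \<open>norm g\<close> is at most the maximum of \<open>\<phi>\<close> on the unit neighbourhood of the
  projection of \<open>K\<close>, minus the minimal height of \<open>K\<close> (\<open>norm_gradient_le\<close>). As
  \<open>norm g \<ge> x \<bullet> g / norm x\<close>, which tends to infinity, \<open>x\<close> is confined to a ball. Then \<open>y\<close> is
  bounded above by the maximum of \<open>\<phi>\<close> on that ball, and below because \<open>E\<close> and \<open>K\<close> are both
  bounded below.
\<close>

text \<open>The one-dimensional tangent inequality, applied along the line through \<open>x\<close> and \<open>z\<close>.\<close>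

lemma convex_on_above_tangent_plane:
  fixes f :: "'a::real_inner \<Rightarrow> real"
  assumes convex: "convex_on UNIV f" and grad: "GDERIV f x :> g"
  shows "f x + g \<bullet> (z - x) \<le> f z"
proof -
  define h where "h t = f (x + t *\<^sub>R (z - x))" for t :: real
  have "convex_on UNIV h"
  proof (rule convex_onI)
    fix t a b :: real
    assume t: "0 < t" "t < 1"
    have "x + ((1 - t) *\<^sub>R a + t *\<^sub>R b) *\<^sub>R (z - x)
        = (1 - t) *\<^sub>R (x + a *\<^sub>R (z - x)) + t *\<^sub>R (x + b *\<^sub>R (z - x))"
      by (simp add: algebra_simps)
    then show "h ((1 - t) *\<^sub>R a + t *\<^sub>R b) \<le> (1 - t) * h a + t * h b"
      unfolding h_def using convex_onD[OF convex, of t] t by simp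
  qed auto
  moreover have "(h has_field_derivative g \<bullet> (z - x)) (at 0)"
  proof -
    have "((\<lambda>t. x + t *\<^sub>R (z - x)) has_derivative (\<lambda>t. t *\<^sub>R (z - x))) (at (0::real))"
      by (auto intro!: derivative_eq_intros)
    moreover have "(f has_derivative (\<lambda>v. v \<bullet> g)) (at (x + 0 *\<^sub>R (z - x)))"
      using grad by (simp add: gderiv_def)
    ultimately have "(h has_derivative (\<lambda>t. (t *\<^sub>R (z - x)) \<bullet> g)) (at 0)"
      unfolding h_def by (rule has_derivative_compose)
    then show ?thesis
      by (simp add: has_field_derivative_def inner_commute mult_commute_abs)
  qed
  ultimately have "h 1 - h 0 \<ge> g \<bullet> (z - x) * (1 - 0)"
    by (intro convex_on_imp_above_tangent[of UNIV h]) auto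
  then show ?thesis
    by (simp add: h_def)
qed

lemma closed_epigraph:
  fixes f :: "'a::topological_space \<Rightarrow> real"
  assumes "continuous_on UNIV f"
  shows "closed (epigraph UNIV f)"
proof -
  have "closed {p. f (fst p) \<le> snd p}"
    by (intro closed_Collect_le continuous_on_compose2[OF assms] continuous_intros) auto
  then show ?thesis
    by (simp add: epigraph_def)
qed

text \<open>
  The height above the tangent hyperplane at \<open>x\<close> is an affine function on the segment through
  \<open>(x, y)\<close>. It is negative at \<open>(x, y)\<close> and nonnegative at the end in the epigraph, hence negative
  at the end in \<open>K\<close>. The bound \<open>min 0 c \<le> y\<close> holds because the end in the epigraph has
  a nonnegative last coordinate.
\<close>

lemma hull_point_tangent_above:
  fixes f :: "'a::euclidean_space \<Rightarrow> real"
  assumes nonneg: "\<And>x. 0 \<le> f x" and convex: "convex_on UNIV f"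
    and grad: "GDERIV f x :> g" and K: "convex K"
    and mem: "(x, y) \<in> convex hull (epigraph UNIV f \<union> K) - epigraph UNIV f"
  obtains b c where "(b, c) \<in> K" "c < f x + g \<bullet> (b - x)" "min 0 c \<le> y"
proof -
  let ?E = "epigraph UNIV f"
  have E: "convex ?E"
    using convex by (rule convex_epigraphI)
  have "(0, f 0) \<in> ?E"
    by (simp add: mem_epigraph)
  then have "?E \<noteq> {}"
    by blast
  moreover have "K \<noteq> {}"
    using mem E by (auto simp: hull_same)
  ultimately obtain u v p q where uv: "0 \<le> u" "0 \<le> v" "u + v = 1"
    and p: "p \<in> ?E" and q: "q \<in> K" and xy: "(x, y) = u *\<^sub>R p + v *\<^sub>R q"
    using mem convex_hull_union_two[OF E _ K] by blast
  obtain a s where p_eq: "p = (a, s)" by (cases p)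
  obtain b c where q_eq: "q = (b, c)" by (cases q)
  have s: "f a \<le> s"
    using p p_eq by (simp add: mem_epigraph)
  have x: "x = u *\<^sub>R a + v *\<^sub>R b" and y: "y = u * s + v * c"
    using xy by (simp_all add: p_eq q_eq)
  have y_less: "y < f x"
    using mem by (simp add: mem_epigraph)
  have above_E: "f x + g \<bullet> (a - x) \<le> s"
    using convex_on_above_tangent_plane[OF convex grad, of a] s by linarith
  have "u * (g \<bullet> (a - x)) + v * (g \<bullet> (b - x)) = g \<bullet> (x - (u + v) *\<^sub>R x)"
    by (simp add: x algebra_simps inner_add_right inner_diff_right)
  then have "f x = u * (f x + g \<bullet> (a - x)) + v * (f x + g \<bullet> (b - x))"
    using uv by (simp add: distrib_left algebra_simps flip: distrib_right)
  moreover have "u * (f x + g \<bullet> (a - x)) \<le> u * s"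
    using above_E uv(1) by (rule mult_left_mono)
  ultimately have "v * c < v * (f x + g \<bullet> (b - x))"
    using y y_less by linarith
  then have "c < f x + g \<bullet> (b - x)"
    using uv(2) by (simp add: mult_less_cancel_left)
  moreover have "min 0 c \<le> y"
  proof -
    have "0 \<le> u * s"
      using nonneg[of a] s uv(1) by simp
    moreover have "min 0 c \<le> v * c"
      using uv mult_right_mono_neg[of v 1 c] by (cases "c \<ge> 0") auto
    ultimately show ?thesis
      using y by linarith
  qed
  ultimately show ?thesis
    using that q q_eq by blast
qed

text \<open>
  Compare the tangent hyperplane with \<open>f\<close> one unit away from \<open>b\<close> in the direction of steepest
  ascent: there it has risen by \<open>norm g\<close>.
\<close>

lemma norm_gradient_le:
  fixes f :: "'a::real_inner \<Rightarrow> real"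
  assumes convex: "convex_on UNIV f" and grad: "GDERIV f x :> g"
    and above: "c \<le> f x + g \<bullet> (b - x)"
    and bound: "\<And>z. z \<in> cball b 1 \<Longrightarrow> f z \<le> M"
  shows "norm g \<le> M - c"
proof -
  have "g \<bullet> sgn g = norm g"
    by (cases "g = 0") (simp_all add: sgn_div_norm dot_square_norm power2_eq_square)
  moreover have "b + sgn g \<in> cball b 1"
    by (simp add: dist_norm norm_sgn)
  ultimately show ?thesis
    using convex_on_above_tangent_plane[OF convex grad, of "b + sgn g"] bound[of "b + sgn g"] above
    by (simp add: inner_add_right inner_diff_right)
qed

theorem corollary3p9:
  fixes \<phi> :: "real ^ 'm \<Rightarrow> real"
    and grad_\<phi> :: "real ^ 'm \<Rightarrow> real ^ 'm"
  assumes nonneg: "\<And>x. 0 \<le> \<phi> x"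
    and convex: "convex_on UNIV \<phi>"
    and grad: "\<And>x. GDERIV \<phi> x :> grad_\<phi> x"
    and C1: "continuous_on UNIV grad_\<phi>"
    and lim: "filterlim (\<lambda>x. (x \<bullet> grad_\<phi> x) / norm x) at_top at_infinity"
  shows "BCEH (epigraph UNIV \<phi>)"
proof -
  let ?E = "epigraph UNIV \<phi>"
  have cont: "continuous_on UNIV \<phi>"
    using grad unfolding gderiv_def
    by (auto simp: continuous_on_eq_continuous_at intro: has_derivative_continuous)
  have bounded_on_ball: "\<exists>M. \<forall>x\<in>cball 0 r. \<phi> x \<le> M" for r
  proof -
    have "compact (\<phi> ` cball 0 r)"
      by (intro compact_continuous_image continuous_on_subset[OF cont]) auto
    then have "bdd_above (\<phi> ` cball 0 r)"
      by (intro bounded_imp_bdd_above compact_imp_bounded)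
    then show ?thesis
      by (auto simp: bdd_above_def)
  qed
  have "bounded (convex hull (?E \<union> K) - ?E)" if K: "compact K" "convex K" for K
  proof -
    obtain R where R: "R > 0" "\<And>p. p \<in> K \<Longrightarrow> norm p \<le> R"
      using compact_imp_bounded[OF K(1)] by (auto simp: bounded_pos)
    obtain M where M: "\<And>z. z \<in> cball 0 (R + 1) \<Longrightarrow> \<phi> z \<le> M"
      using bounded_on_ball by blast
    have "\<forall>\<^sub>F x in at_infinity. M + R < (x \<bullet> grad_\<phi> x) / norm x"
      using lim by (simp add: filterlim_at_top_dense)
    then obtain X where X: "\<And>x. X \<le> norm x \<Longrightarrow> M + R < (x \<bullet> grad_\<phi> x) / norm x"
      by (auto simp: eventually_at_infinity)
    obtain N where N: "\<And>x. x \<in> cball 0 X \<Longrightarrow> \<phi> x \<le> N"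
      using bounded_on_ball by blast
    have "convex hull (?E \<union> K) - ?E \<subseteq> cball 0 X \<times> {-R..N}"
    proof clarify
      fix x y
      assume mem: "(x, y) \<in> convex hull (?E \<union> K)" "(x, y) \<notin> ?E"
      then obtain b c where bc: "(b, c) \<in> K"
        and above: "c < \<phi> x + grad_\<phi> x \<bullet> (b - x)" and y: "min 0 c \<le> y"
        using hull_point_tangent_above[OF nonneg convex grad K(2), of x y] by blast
      have b: "norm b \<le> R" and c: "\<bar>c\<bar> \<le> R"
        using R(2)[OF bc] norm_fst_le[of b c] norm_snd_le[of c b] by auto
      have "\<phi> z \<le> M" if "z \<in> cball b 1" for z
        using that b norm_triangle_sub[of z b] by (intro M) (simp add: dist_norm norm_minus_commute)
      then have "norm (grad_\<phi> x) \<le> M + R"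
        using norm_gradient_le[OF convex grad, of c x b M] above c by force
      moreover have "(x \<bullet> grad_\<phi> x) / norm x \<le> norm (grad_\<phi> x)"
        using norm_cauchy_schwarz[of x "grad_\<phi> x"]
        by (cases "x = 0") (simp_all add: divide_le_eq mult.commute)
      ultimately have x: "x \<in> cball 0 X"
        using X[of x] by fastforce
      have "y < \<phi> x"
        using mem(2) by (simp add: mem_epigraph)
      then show "x \<in> cball 0 X \<and> y \<in> {-R..N}"
        using x N[OF x] y c R(1) by auto
    qed
    then show ?thesis
      by (rule bounded_subset[rotated]) (intro bounded_Times bounded_cball bounded_closed_interval)
  qed
  then show ?thesis
    using closed_epigraph[OF cont] convex_epigraphI[OF convex] by (auto simp: BCEH_def)
qed

end
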